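(* Let $H$ be a separable complex Hilbert space. Let $U$ be a cramped unitary operator on $H$, and let $T$ be a densely defined closed linear operator in $H$ (with domain $D(T)\subset H$) such that $UT=T^*U$. Then $T$ is self-adjoint, i.e. $T=T^*$.
   Context: A unitary operator $U$ on $H$ is called cramped if its spectrum is contained in some open semicircle of the unit circle, i.e. in $\{e^{i\theta}:\theta_0<\theta<\theta_0+\pi\}$ for some $\theta_0\in\mathbb{R}$. The operator $T$ is not assumed to be bounded. Products of (possibly unbounded) operators $A,B$ are defined by $(AB)x=A(Bx)$ on $D(AB)=\{x\in D(B): Bx\in D(A)\}$. Equality of operators includes equality of domains; thus $UT=T^*U$ means that $D(T)=\{x\in H: Ux\in D(T^* )\}$ and that $UTx=T^*Ux$ for every $x\in D(T)$. *)

theory Defs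
  imports "HOL-Analysis.Analysis"
begin

section \<open>Complex Hilbert spaces\<close>

text \<open>A complex inner product space, as a real normed space with a compatible complex
  scalar multiplication whose norm is induced by a sesquilinear form. The inner product is
  conjugate-linear in the first and linear in the second argument.\<close>

class complex_inner = real_normed_vector +
  fixes scaleC :: "complex \<Rightarrow> 'a \<Rightarrow> 'a"  (infixr \<open>*\<^sub>C\<close> 75)
    and cinner :: "'a \<Rightarrow> 'a \<Rightarrow> complex"
  assumes scaleC_of_real: "complex_of_real r *\<^sub>C x = r *\<^sub>R x"
    and scaleC_add_right: "c *\<^sub>C (x + y) = c *\<^sub>C x + c *\<^sub>C y"
    and scaleC_add_left: "(c + d) *\<^sub>C x = c *\<^sub>C x + d *\<^sub>C x"
    and scaleC_scaleC: "c *\<^sub>C (d *\<^sub>C x) = (c * d) *\<^sub>C x"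
    and cinner_commute: "cinner x y = cnj (cinner y x)"
    and cinner_add_right: "cinner x (y + z) = cinner x y + cinner x z"
    and cinner_scaleC_right: "cinner x (c *\<^sub>C y) = c * cinner x y"
    and norm_eq_sqrt_cinner: "norm x = sqrt (Re (cinner x x))"

class chilbert_space = complex_inner + complete_space

instantiation complex :: chilbert_space
begin

definition scaleC_complex :: "complex \<Rightarrow> complex \<Rightarrow> complex"
  where "scaleC_complex c x = c * x"

definition cinner_complex :: "complex \<Rightarrow> complex \<Rightarrow> complex"
  where "cinner_complex x y = cnj x * y"

instance
  by standard
    (auto simp: scaleC_complex_def cinner_complex_def algebra_simps scaleR_conv_of_real
      cmod_def power2_eq_square)

end

section \<open>Everywhere defined bounded operators\<close>

definition bounded_clinear :: "('a::complex_inner \<Rightarrow> 'a) \<Rightarrow> bool"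
  where "bounded_clinear A \<longleftrightarrow> bounded_linear A \<and> (\<forall>c x. A (c *\<^sub>C x) = c *\<^sub>C A x)"

definition unitary :: "('a::complex_inner \<Rightarrow> 'a) \<Rightarrow> bool"
  where "unitary U \<longleftrightarrow>
    bounded_clinear U \<and> surj U \<and> (\<forall>x y. cinner (U x) (U y) = cinner x y)"

definition spectrum :: "('a::complex_inner \<Rightarrow> 'a) \<Rightarrow> complex set"
  where "spectrum A = {\<mu>. \<not> (\<exists>R. bounded_clinear R \<and>
    (\<forall>x. R (A x - \<mu> *\<^sub>C x) = x) \<and> (\<forall>x. A (R x) - \<mu> *\<^sub>C R x = x))}"

definition cramped :: "('a::complex_inner \<Rightarrow> 'a) \<Rightarrow> bool"
  where "cramped U \<longleftrightarrow>
    (\<exists>\<theta>\<^sub>0::real. spectrum U \<subseteq> {cis \<theta> |\<theta>. \<theta>\<^sub>0 < \<theta> \<and> \<theta> < \<theta>\<^sub>0 + pi})"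

section \<open>Unbounded operators\<close>

text \<open>A possibly unbounded operator in \<open>H\<close> is a partial map \<open>T :: 'a \<rightharpoonup> 'a\<close> with domain
  \<^term>\<open>dom T\<close>. Equality of partial maps includes equality of domains, and
  \<open>A \<circ>\<^sub>m B\<close> is the operator product, with domain
  \<open>{x \<in> dom B. the (B x) \<in> dom A}\<close>. An everywhere defined operator \<open>U :: 'a \<Rightarrow> 'a\<close>
  becomes \<open>everywhere U\<close>.\<close>

type_synonym 'a operator = "'a \<rightharpoonup> 'a"

definition everywhere :: "('a \<Rightarrow> 'a) \<Rightarrow> 'a operator"
  where "everywhere U = (\<lambda>x. Some (U x))"

definition linear_operator :: "'a::complex_inner operator \<Rightarrow> bool"
  where "linear_operator T \<longleftrightarrow> T 0 = Some 0 \<and>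
    (\<forall>x y u v. T x = Some u \<and> T y = Some v \<longrightarrow> T (x + y) = Some (u + v)) \<and>
    (\<forall>c x u. T x = Some u \<longrightarrow> T (c *\<^sub>C x) = Some (c *\<^sub>C u))"

definition densely_defined :: "'a::complex_inner operator \<Rightarrow> bool"
  where "densely_defined T \<longleftrightarrow> closure (dom T) = UNIV"

definition closed_operator :: "'a::complex_inner operator \<Rightarrow> bool"
  where "closed_operator T \<longleftrightarrow> closed (Map.graph T)"

text \<open>The Hilbert space adjoint. The vector \<open>z\<close> below is unique if \<open>T\<close> is densely defined;
  for other \<open>T\<close> the value of \<open>adjoint_operator T\<close> carries no meaning.\<close>

definition adjoint_operator :: "'a::complex_inner operator \<Rightarrow> 'a operator"
  where "adjoint_operator T = (\<lambda>y.
    if \<exists>z. \<forall>x \<in> dom T. cinner y (the (T x)) = cinner z x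
    then Some (THE z. \<forall>x \<in> dom T. cinner y (the (T x)) = cinner z x)
    else None)"

definition self_adjoint :: "'a::complex_inner operator \<Rightarrow> bool"
  where "self_adjoint T \<longleftrightarrow> T = adjoint_operator T"

end

theory Submission
  imports Defs
begin

text \<open>The relation \<open>U T = T\<^sup>* U\<close> says that \<open>W = U \<times> U\<close> maps the graph \<open>G\<close> of \<open>T\<close> onto the
  graph \<open>G'\<close> of \<open>T\<^sup>*\<close>. The graph of an adjoint is the orthogonal complement of the graph turned
  by \<open>(x, u) \<mapsto> (u, - x)\<close>, an operation that commutes with \<open>W\<close>; since \<open>G\<close> is closed and
  hence equal to its double complement, \<open>W\<close> also maps \<open>G'\<close> back onto \<open>G\<close>. It remains to show that
  a cramped unitary cannot exchange two different closed subspaces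
  (\<open>cramped_unitary_exchange\<close>).

  Crampedness gives a unimodular \<open>c\<close> for which the spectrum of \<open>c W\<close> lies in the open right half
  plane, and then the symmetric operator \<open>H = (c W + (c W)\<^sup>-\<^sup>1) / 2\<close> satisfies
  \<open>\<langle>x, H x\<rangle> \<ge> \<delta> \<parallel>x\<parallel>\<^sup>2\<close> with some \<open>\<delta> > 0\<close> (\<open>cramped_coercive\<close>). Both \<open>W\<close> and its
  inverse exchange \<open>G\<close> and \<open>G'\<close>, so \<open>H\<close> maps each of the two into the other, and \<open>H\<^sup>2\<close> maps
  each into itself. Now \<open>H\<close> is the positive square root of \<open>H\<^sup>2\<close>, hence a limit of polynomials in
  \<open>H\<^sup>2\<close>, so \<open>H\<close> itself preserves \<open>G'\<close> (\<open>square_invariant_imp_invariant\<close>). Finally,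
  for \<open>x \<in> G\<close> the Neumann series \<open>x = (\<Sum>k. (1 - \<delta> H)\<^sup>k (\<delta> H x))\<close> starts from \<open>\<delta> H x \<in> G'\<close>
  and stays in \<open>G'\<close>, so \<open>x \<in> G'\<close>; the other inclusion is symmetric
  (\<open>coercive_exchange_subset\<close>).\<close>

section \<open>The underlying real inner product\<close>

definition rinner :: "'a::complex_inner \<Rightarrow> 'a \<Rightarrow> real"
  where "rinner x y = Re (cinner x y)"

lemma rinner_commute: "rinner x y = rinner y x"
  unfolding rinner_def by (subst cinner_commute) simp

lemma rinner_self: "rinner x x = (norm x)\<^sup>2"
proof -
  have "sqrt (rinner x x) \<ge> 0"
    using norm_ge_zero[of x] unfolding norm_eq_sqrt_cinner rinner_def .
  then show ?thesis
    by (simp add: norm_eq_sqrt_cinner rinner_def)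
qed

lemma rinner_add_right: "rinner x (y + z) = rinner x y + rinner x z"
  by (simp add: rinner_def cinner_add_right)

lemma rinner_add_left: "rinner (x + y) z = rinner x z + rinner y z"
  using rinner_add_right rinner_commute by metis

lemma rinner_scaleR_right: "rinner x (r *\<^sub>R y) = r * rinner x y"
  unfolding rinner_def by (simp flip: scaleC_of_real add: cinner_scaleC_right)

lemma rinner_scaleR_left: "rinner (r *\<^sub>R x) y = r * rinner x y"
  using rinner_scaleR_right rinner_commute by metis

text \<open>Cauchy-Schwarz comes for free from the triangle inequality, which is part of the class of
  normed spaces.\<close>

lemma abs_rinner_le: "\<bar>rinner x y\<bar> \<le> norm x * norm y"
proof -
  have le: "rinner x y \<le> norm x * norm y" for x y :: 'a
  proof -
    have "(norm (x + y))\<^sup>2 \<le> (norm x + norm y)\<^sup>2"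
      by (intro power_mono norm_triangle_ineq) simp
    then show ?thesis
      by (simp add: rinner_add_left rinner_add_right rinner_commute power2_sum flip: rinner_self)
  qed
  have "- rinner x y = rinner ((-1) *\<^sub>R x) y"
    by (simp only: rinner_scaleR_left)
  with le[of x y] le[of "(-1) *\<^sub>R x" y] show ?thesis
    by simp
qed

lemma bounded_bilinear_rinner: "bounded_bilinear (rinner :: 'a::complex_inner \<Rightarrow> _)"
  by (standard; (intro exI[of _ 1])?)
     (auto simp: rinner_add_right rinner_add_left rinner_scaleR_right rinner_scaleR_left abs_rinner_le)

interpretation rinner: bounded_bilinear rinner
  by (rule bounded_bilinear_rinner)

lemma norm_diff_squared: "(norm (x - y))\<^sup>2 = (norm x)\<^sup>2 - 2 * rinner x y + (norm y)\<^sup>2"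
  for x y :: "'a::complex_inner"
  by (simp add: rinner.diff_left rinner.diff_right rinner_commute flip: rinner_self)

lemma parallelogram_law:
  "(norm (x + y))\<^sup>2 + (norm (x - y))\<^sup>2 = 2 * (norm x)\<^sup>2 + 2 * (norm y)\<^sup>2"
  for x y :: "'a::complex_inner"
  by (simp add: rinner.diff_left rinner.diff_right rinner.add_left rinner.add_right rinner_commute
      flip: rinner_self)

lemma Im_cinner: "Im (cinner x y) = - rinner x (\<i> *\<^sub>C y)"
  by (simp add: rinner_def cinner_scaleC_right)

lemma cinner_eq_0_iff: "cinner x y = 0 \<longleftrightarrow> rinner x y = 0 \<and> rinner x (\<i> *\<^sub>C y) = 0"
  by (simp add: complex_eq_iff Im_cinner flip: rinner_def)

lemma cinner_add_left: "cinner (x + y) z = cinner x z + cinner y z"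
  by (metis cinner_commute cinner_add_right complex_cnj_add)

lemma cinner_scaleC_left: "cinner (c *\<^sub>C x) y = cnj c * cinner x y"
  by (metis cinner_commute cinner_scaleC_right complex_cnj_mult)

lemma norm_scaleC: "norm (c *\<^sub>C x) = cmod c * norm x"
proof -
  have "cinner (c *\<^sub>C x) (c *\<^sub>C x) = of_real ((cmod c)\<^sup>2) * cinner x x"
    by (simp only: cinner_scaleC_left cinner_scaleC_right complex_norm_square mult_ac)
  then have "(norm (c *\<^sub>C x))\<^sup>2 = (cmod c * norm x)\<^sup>2"
    by (simp add: rinner_def power_mult_distrib flip: rinner_self)
  then show ?thesis
    by (simp add: power2_eq_iff_nonneg)
qed

lemma scaleC_one [simp]: "1 *\<^sub>C x = x"
  using scaleC_of_real[of 1 x] by simp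

lemma scaleC_zero_right [simp]: "c *\<^sub>C 0 = 0"
  using scaleC_add_right[of c 0 0] by simp

lemma scaleC_minus_right: "c *\<^sub>C (- x) = - (c *\<^sub>C x)"
  using scaleC_add_right[of c x "- x"] by (simp add: minus_unique)

lemma scaleC_diff_right: "c *\<^sub>C (x - y) = c *\<^sub>C x - c *\<^sub>C y"
  using scaleC_add_right[of c x "- y"] by (simp add: scaleC_minus_right)

lemma scaleC_scaleR: "c *\<^sub>C (r *\<^sub>R x) = r *\<^sub>R (c *\<^sub>C x)"
  by (simp add: scaleC_scaleC mult.commute flip: scaleC_of_real)

lemma bounded_linear_scaleC: "bounded_linear (\<lambda>x :: 'a::complex_inner. c *\<^sub>C x)"
  by (rule bounded_linear_intro[of _ "cmod c"])
     (simp_all add: scaleC_add_right scaleC_scaleR norm_scaleC mult.commute)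

section \<open>Closed subspaces and orthogonal complements\<close>

definition complex_subspace :: "'a::complex_inner set \<Rightarrow> bool"
  where "complex_subspace M \<longleftrightarrow> subspace M \<and> (\<forall>c. \<forall>x\<in>M. c *\<^sub>C x \<in> M)"

definition orthocomplement :: "'a::complex_inner set \<Rightarrow> 'a set"
  where "orthocomplement M = {x. \<forall>y\<in>M. cinner x y = 0}"

lemma cinner_0_right [simp]: "cinner x 0 = 0"
  using cinner_add_right[of x 0 0] by simp

lemma cinner_0_left [simp]: "cinner 0 x = 0"
  using cinner_commute[of 0 x] by simp

lemma cinner_minus_right: "cinner x (- y) = - cinner x y"
  using cinner_add_right[of x y "- y"] by (simp add: minus_unique)

lemma complex_subspace_orthocomplement: "complex_subspace (orthocomplement M)"
  by (auto simp: complex_subspace_def subspace_def orthocomplement_def cinner_add_left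
      cinner_scaleC_left simp flip: scaleC_of_real)

lemma closed_orthocomplement: "closed (orthocomplement M)"
proof -
  have "orthocomplement M =
      (\<Inter>y\<in>M. {x. rinner x y = 0} \<inter> {x. rinner x (\<i> *\<^sub>C y) = 0})"
    by (auto simp: orthocomplement_def cinner_eq_0_iff)
  moreover have "closed {x. rinner x y = 0}" for y :: 'a
    by (intro closed_Collect_eq continuous_intros rinner.continuous_on)
  ultimately show ?thesis
    by (simp add: closed_INT closed_Int)
qed

text \<open>A minimising sequence for the distance to a closed subspace is Cauchy by the parallelogram
  law, because the midpoint of two of its members is again in the subspace.\<close>

lemma exists_nearest_point:
  fixes M :: "'a::chilbert_space set"
  assumes "closed M" and "subspace M"
  shows "\<exists>y\<in>M. \<forall>z\<in>M. norm (x - y) \<le> norm (x - z)"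
proof -
  define d where "d = infdist x M"
  have ne: "M \<noteq> {}"
    using assms(2) subspace_0 by blast
  have d_le: "d \<le> norm (x - z)" if "z \<in> M" for z
    using infdist_le[OF that, of x] by (simp add: d_def dist_norm)
  have d0: "0 \<le> d"
    by (simp add: d_def infdist_nonneg)
  have "\<exists>y\<in>M. (norm (x - y))\<^sup>2 < d\<^sup>2 + e" if "e > 0" for e
  proof -
    have "d < sqrt (d\<^sup>2 + e)"
      using that d0 by (simp add: real_less_rsqrt)
    then obtain y where y: "y \<in> M" "dist x y < sqrt (d\<^sup>2 + e)"
      unfolding d_def infdist_notempty[OF ne] 
      by (subst (asm) cINF_less_iff) (use ne in auto)
    then have "(norm (x - y))\<^sup>2 < (sqrt (d\<^sup>2 + e))\<^sup>2"
      by (intro power_strict_mono) (auto simp: dist_norm)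
    with y that show ?thesis
      by auto
  qed
  then have "\<forall>n. \<exists>y\<in>M. (norm (x - y))\<^sup>2 < d\<^sup>2 + inverse (real (Suc n))"
    by auto
  then obtain y where yM: "\<And>n. y n \<in> M"
    and y: "\<And>n. (norm (x - y n))\<^sup>2 < d\<^sup>2 + inverse (real (Suc n))"
    by metis
  have mid: "(norm (y m - y n))\<^sup>2 \<le> 2 * inverse (real (Suc m)) + 2 * inverse (real (Suc n))" for m n
  proof -
    have "(1/2) *\<^sub>R (y m + y n) \<in> M"
      using assms(2) yM by (simp add: subspace_add subspace_scale)
    from d_le[OF this] have "d\<^sup>2 \<le> (norm (x - (1/2) *\<^sub>R (y m + y n)))\<^sup>2"
      using d0 by (intro power_mono)
    also have "norm (x - (1/2) *\<^sub>R (y m + y n)) = norm ((1/2) *\<^sub>R ((x - y n) + (x - y m)))"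
      by (rule arg_cong[of _ _ norm]) (simp add: algebra_simps flip: scaleR_add_left)
    finally have "4 * d\<^sup>2 \<le> (norm ((x - y n) + (x - y m)))\<^sup>2"
      by (simp add: power_divide)
    then show ?thesis
      using parallelogram_law[of "x - y n" "x - y m"] y[of m] y[of n] by simp
  qed
  have "Cauchy y"
  proof (rule metric_CauchyI)
    fix e :: real
    assume "e > 0"
    then obtain N where N: "inverse (real (Suc N)) < e\<^sup>2 / 4"
      using reals_Archimedean[of "e\<^sup>2 / 4"] by auto
    have "dist (y m) (y n) < e" if "m \<ge> N" "n \<ge> N" for m n
    proof -
      have "inverse (real (Suc m)) \<le> inverse (real (Suc N))"
        "inverse (real (Suc n)) \<le> inverse (real (Suc N))"
        using that by (auto simp del: of_nat_Suc)
      then have "(norm (y m - y n))\<^sup>2 < e\<^sup>2"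
        using mid[of m n] N by linarith
      then show ?thesis
        using \<open>e > 0\<close> by (simp add: dist_norm power_less_imp_less_base)
    qed
    then show "\<exists>N. \<forall>m\<ge>N. \<forall>n\<ge>N. dist (y m) (y n) < e"
      by blast
  qed
  then obtain z where lim: "y \<longlonglongrightarrow> z"
    using Cauchy_convergent_iff convergent_def by blast
  have "z \<in> M"
    using assms(1) yM lim closed_sequentially by blast
  moreover have "(norm (x - z))\<^sup>2 \<le> d\<^sup>2 + 0"
  proof (rule LIMSEQ_le)
    show "(\<lambda>n. (norm (x - y n))\<^sup>2) \<longlonglongrightarrow> (norm (x - z))\<^sup>2"
      by (intro tendsto_intros lim)
    show "(\<lambda>n. d\<^sup>2 + inverse (real (Suc n))) \<longlonglongrightarrow> d\<^sup>2 + 0"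
      by (intro tendsto_intros LIMSEQ_inverse_real_of_nat)
  qed (use y less_imp_le in blast)
  then have "norm (x - z) \<le> d"
    using d0 by (simp add: power2_le_iff_abs_le)
  ultimately show ?thesis
    using d_le order_trans by blast
qed

text \<open>The residual of the nearest point is orthogonal to \<open>M\<close> in the real sense; applying this to
  \<open>y\<close> and \<open>\<i> y\<close> gives complex orthogonality. A point of the double complement is therefore
  orthogonal to its own residual, which must vanish.\<close>

lemma double_orthocomplement:
  fixes M :: "'a::chilbert_space set"
  assumes "closed M" and sub: "complex_subspace M"
  shows "orthocomplement (orthocomplement M) = M"
proof
  show "M \<subseteq> orthocomplement (orthocomplement M)"
    by (auto simp: orthocomplement_def) (metis cinner_commute complex_cnj_zero)
  show "orthocomplement (orthocomplement M) \<subseteq> M"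
  proof
    fix x
    assume x: "x \<in> orthocomplement (orthocomplement M)"
    obtain y where y: "y \<in> M" and near: "\<And>z. z \<in> M \<Longrightarrow> norm (x - y) \<le> norm (x - z)"
      using exists_nearest_point[of M x] assms complex_subspace_def by metis
    have orth: "rinner (x - y) m = 0" if "m \<in> M" for m
    proof (cases "m = 0")
      case False
      \<comment> \<open>The step from \<open>y\<close> in direction \<open>m\<close> that decreases the distance most.\<close>
      define t where "t = rinner (x - y) m / (norm m)\<^sup>2"
      have "y + t *\<^sub>R m \<in> M"
        using sub y that by (simp add: complex_subspace_def subspace_add subspace_scale)
      from near[OF this] have "(norm (x - y))\<^sup>2 \<le> (norm ((x - y) - t *\<^sub>R m))\<^sup>2"
        by (simp add: diff_diff_eq power_mono)
      then have "0 \<le> - 2 * t * rinner (x - y) m + t\<^sup>2 * (norm m)\<^sup>2"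
        by (simp add: norm_diff_squared[of "x - y"] rinner.scaleR_right power_mult_distrib)
      also have "\<dots> = - (rinner (x - y) m)\<^sup>2 / (norm m)\<^sup>2"
        using False by (simp add: t_def power2_eq_square field_simps)
      finally show ?thesis
        using False by (simp add: divide_le_0_iff zero_le_divide_iff)
    qed (simp add: rinner.zero_right)
    then have "x - y \<in> orthocomplement M"
      using sub by (auto simp: orthocomplement_def cinner_eq_0_iff complex_subspace_def)
    then have "rinner x (x - y) = 0" "rinner (x - y) y = 0"
      using x orth[OF y] by (auto simp: orthocomplement_def rinner_def)
    then have "(norm (x - y))\<^sup>2 = 0"
      by (simp add: rinner.diff_left rinner.diff_right rinner_commute flip: rinner_self)
    then show "x \<in> M"
      using y by simp
  qed
qed

section \<open>Numerical range of a cramped unitary\<close>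

text \<open>The infimum \<open>m\<close> of the numerical range of a symmetric operator is an approximate
  eigenvalue: \<open>P = H - m\<close> is positive, and evaluating its form at \<open>x - P x / 2\<close> bounds
  \<open>(norm (P x))\<^sup>2\<close> by twice the form at \<open>x\<close>, which has infimum \<open>0\<close> over unit vectors. If no
  number \<open>\<le> 0\<close> is an approximate eigenvalue, then \<open>m\<close> is positive.\<close>

lemma symmetric_contraction_coercive:
  fixes H :: "'a::complex_inner \<Rightarrow> 'a"
  assumes lin: "linear H" and sym: "\<And>x y. rinner (H x) y = rinner x (H y)"
    and contr: "\<And>x. norm (H x) \<le> norm x"
    and below: "\<And>l. l \<le> 0 \<Longrightarrow> \<exists>k>0. \<forall>x. k * norm x \<le> norm (H x - l *\<^sub>R x)"
  shows "\<exists>\<delta>>0. \<forall>x. \<delta> * (norm x)\<^sup>2 \<le> rinner x (H x)"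
proof (cases "\<exists>x::'a. x \<noteq> 0")
  case False
  then show ?thesis
    by (intro exI[of _ 1]) (metis abs_rinner_le abs_le_zero_iff mult_zero_left norm_zero
        order_refl power_zero_numeral mult_zero_right zero_less_one)
next
  case True
  then obtain x0 :: 'a where x0: "x0 \<noteq> 0" ..
  define S where "S = (\<lambda>x. rinner x (H x)) ` sphere 0 1"
  have S_bound: "-1 \<le> s \<and> s \<le> 1" if s: "s \<in> S" for s
  proof -
    obtain x where "s = rinner x (H x)" "norm x = 1"
      using s by (auto simp: S_def)
    then show ?thesis
      using abs_rinner_le[of x "H x"] contr[of x] by auto
  qed
  have ne: "S \<noteq> {}"
  proof -
    have "inverse (norm x0) *\<^sub>R x0 \<in> sphere 0 1"
      using x0 by simp
    then show ?thesis
      unfolding S_def by blast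
  qed
  have bdd: "bdd_below S"
    using S_bound by (intro bdd_belowI[of _ "-1"]) blast
  define m where "m = Inf S"
  have m1: "\<bar>m\<bar> \<le> 1"
  proof -
    obtain s where s: "s \<in> S"
      using ne by blast
    have "m \<le> 1"
      unfolding m_def using cInf_lower[OF s bdd] S_bound[OF s] by simp
    moreover have "-1 \<le> m"
      unfolding m_def by (rule cInf_greatest[OF ne]) (use S_bound in blast)
    ultimately show ?thesis
      by simp
  qed
  have scale: "l * (norm x)\<^sup>2 \<le> rinner x (H x)" if "\<And>s. s \<in> S \<Longrightarrow> l \<le> s" for l x
  proof (cases "x = 0")
    case False
    define u where "u = inverse (norm x) *\<^sub>R x"
    have "rinner u (H u) \<in> S"
      using False by (auto simp: S_def u_def)
    from that[OF this] have "l * (norm x)\<^sup>2 \<le> rinner u (H u) * (norm x)\<^sup>2"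
      by (intro mult_right_mono) auto
    also have "\<dots> = rinner x (H x)"
      using False by (simp add: u_def linear_scale[OF lin] rinner.scaleR_left rinner.scaleR_right
          power2_eq_square field_simps)
    finally show ?thesis .
  qed (simp add: rinner.zero_left)
  have m_le: "m * (norm x)\<^sup>2 \<le> rinner x (H x)" for x
    by (rule scale) (auto simp: m_def intro: cInf_lower bdd)
  have "m > 0"
  proof (rule ccontr)
    assume "\<not> m > 0"
    then obtain k where k: "k > 0" "\<And>x. k * norm x \<le> norm (H x - m *\<^sub>R x)"
      using below[of m] by auto
    define P where "P x = H x - m *\<^sub>R x" for x
    have P_form: "rinner x (P x) = rinner x (H x) - m * (norm x)\<^sup>2" for x
      by (simp add: P_def rinner.diff_right rinner.scaleR_right rinner_self)
    have P_norm: "rinner y (P y) \<le> 2 * (norm y)\<^sup>2" for y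
    proof -
      have "norm y * norm (P y) \<le> norm y * (norm y + norm y)"
      proof (rule mult_left_mono)
        have "norm (P y) \<le> norm (H y) + norm (m *\<^sub>R y)"
          unfolding P_def by (rule norm_triangle_ineq4)
        also have "\<dots> \<le> norm y + norm y"
          using m1 mult_right_mono[of "\<bar>m\<bar>" 1 "norm y"] contr[of y] by simp
        finally show "norm (P y) \<le> norm y + norm y" .
      qed simp
      then show ?thesis
        using abs_rinner_le[of y "P y"] by (simp add: power2_eq_square algebra_simps)
    qed
    have P_lin: "P (x - r *\<^sub>R y) = P x - r *\<^sub>R P y" for x y r
      by (simp add: P_def linear_diff[OF lin] linear_scale[OF lin] algebra_simps)
    have P_sym: "rinner (P x) y = rinner x (P y)" for x y
      by (simp add: P_def sym rinner.diff_left rinner.diff_right rinner.scaleR_left rinner.scaleR_right)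
    have P_le: "(norm (P x))\<^sup>2 \<le> 2 * rinner x (P x)" for x
    proof -
      have "0 \<le> rinner (x - (1/2) *\<^sub>R P x) (P (x - (1/2) *\<^sub>R P x))"
        using m_le P_form by simp
      also have "\<dots> = rinner x (P x) - (norm (P x))\<^sup>2 + rinner (P x) (P (P x)) / 4"
        by (simp add: P_lin rinner.diff_left rinner.diff_right rinner.scaleR_left
            rinner.scaleR_right flip: P_sym rinner_self) (simp add: field_simps)
      finally show ?thesis
        using P_norm[of "P x"] by simp
    qed
    have "m + k\<^sup>2 / 2 \<le> s" if s: "s \<in> S" for s
    proof -
      obtain x where x: "s = rinner x (H x)" "norm x = 1"
        using s by (auto simp: S_def)
      have "k\<^sup>2 \<le> (norm (P x))\<^sup>2"
        using k(1) k(2)[of x] x by (intro power_mono) (auto simp: P_def)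
      then show ?thesis
        using P_le[of x] P_form[of x] x by simp
    qed
    then have "m + k\<^sup>2 / 2 \<le> m"
      unfolding m_def using ne by (intro cInf_greatest)
    then show False
      using k(1) by simp
  qed
  with m_le show ?thesis
    by blast
qed

text \<open>For unitary \<open>U\<close> and unimodular \<open>c\<close> this is the real part \<open>(V + V\<^sup>*) / 2\<close> of \<open>V = c U\<close>.\<close>

definition rotated_real_part :: "complex \<Rightarrow> ('a::complex_inner \<Rightarrow> 'a) \<Rightarrow> 'a \<Rightarrow> 'a"
  where "rotated_real_part c U x = (1/2) *\<^sub>R (c *\<^sub>C U x + cnj c *\<^sub>C inv U x)"

lemma unitary_norm: "unitary U \<Longrightarrow> norm (U x) = norm x"
  by (simp add: unitary_def norm_eq_sqrt_cinner)

lemma unitary_bounded_linear: "unitary U \<Longrightarrow> bounded_linear U"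
  by (simp add: unitary_def bounded_clinear_def)

lemma unitary_scaleC: "unitary U \<Longrightarrow> U (c *\<^sub>C x) = c *\<^sub>C U x"
  by (simp add: unitary_def bounded_clinear_def)

lemma unitary_bij:
  assumes "unitary U" shows "bij U"
proof -
  have "U x = U y \<Longrightarrow> x = y" for x y
    using unitary_norm[OF assms, of "x - y"] 
      linear_diff[OF bounded_linear.linear[OF unitary_bounded_linear[OF assms]], of x y] by simp
  then show ?thesis
    using assms by (auto simp: bij_def inj_def unitary_def)
qed

lemma unitary_inv_right: "unitary U \<Longrightarrow> U (inv U x) = x"
  using unitary_bij[of U] by (simp add: bij_is_surj surj_f_inv_f)

lemma unitary_inv_left: "unitary U \<Longrightarrow> inv U (U x) = x"
  using unitary_bij[of U] by (simp add: bij_is_inj)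

lemma unitary_inv:
  assumes "unitary U"
  shows "unitary (inv U)"
proof -
  note U = unitary_inv_left[OF assms] unitary_inv_right[OF assms] unitary_scaleC[OF assms]
  have lin: "linear U"
    using assms unitary_bounded_linear bounded_linear.linear by blast
  have add: "inv U (x + y) = inv U x + inv U y" for x y
    using U(1)[of "inv U x + inv U y"] by (simp add: linear_add[OF lin] U)
  have scale: "inv U (c *\<^sub>C x) = c *\<^sub>C inv U x" for c x
    using U(1)[of "c *\<^sub>C inv U x"] by (simp add: U)
  have "bounded_linear (inv U)"
    by (rule bounded_linear_intro[of _ 1])
      (use add scale unitary_norm[OF assms, of "inv U _"] in 
        \<open>simp_all add: U flip: scaleC_of_real\<close>)
  moreover have "cinner (inv U x) (inv U y) = cinner x y" for x y
    using assms U(2) unfolding unitary_def by metis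
  ultimately show ?thesis
    using scale unitary_bij[OF assms]
    by (simp add: unitary_def bounded_clinear_def bij_imp_bij_inv bij_is_surj)
qed

lemma unitary_adjoint: "unitary U \<Longrightarrow> cinner (inv U x) y = cinner x (U y)"
  by (metis unitary_def unitary_inv_right)

lemma linear_rotated_real_part:
  assumes "unitary U"
  shows "bounded_linear (rotated_real_part c U)"
  unfolding rotated_real_part_def
  by (intro bounded_linear_add bounded_linear_const_scaleR bounded_linear_compose[OF bounded_linear_scaleC]
      unitary_bounded_linear unitary_inv assms)

lemma norm_rotated_real_part:
  assumes "unitary U" "cmod c = 1"
  shows "norm (rotated_real_part c U x) \<le> norm x"
  using norm_triangle_ineq[of "c *\<^sub>C U x" "cnj c *\<^sub>C inv U x"] assms
  by (simp add: rotated_real_part_def norm_scaleC unitary_norm unitary_inv)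

lemma rotated_real_part_symmetric:
  assumes "unitary U"
  shows "rinner (rotated_real_part c U x) y = rinner x (rotated_real_part c U y)"
proof -
  have "cinner (U x) y = cinner x (inv U y)"
    using unitary_adjoint[OF assms] cinner_commute by metis
  then show ?thesis
    unfolding rotated_real_part_def rinner.scaleR_left rinner.scaleR_right
    by (simp add: rinner_def unitary_adjoint[OF assms]
        cinner_add_left cinner_add_right cinner_scaleC_left cinner_scaleC_right)
qed

lemma bounded_below_outside_spectrum:
  assumes "\<mu> \<notin> spectrum A"
  shows "\<exists>k>0. \<forall>x. k * norm x \<le> norm (A x - \<mu> *\<^sub>C x)"
proof -
  obtain R where R: "bounded_linear R" "\<And>x. R (A x - \<mu> *\<^sub>C x) = x"
    using assms by (auto simp: spectrum_def bounded_clinear_def)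
  obtain K where K: "K > 0" "\<And>x. norm (R x) \<le> norm x * K"
    using bounded_linear.pos_bounded[OF R(1)] by blast
  then show ?thesis
    using K(2)[of "A x - \<mu> *\<^sub>C x" for x]
    by (intro exI[of _ "inverse K"]) (auto simp: R(2) field_simps)
qed

text \<open>After rotation by \<open>c\<close> the spectrum of \<open>c U\<close> lies in the open right half plane. With
  \<open>V = c U\<close>, one has \<open>2 V (H - l) = V\<^sup>2 - 2 l V + 1 = (V - p) (V - q)\<close> where \<open>p q = 1\<close> and
  \<open>p + q = 2 l\<close>. For \<open>l \<le> 0\<close> no root on the unit circle has positive real part, so both
  factors are bounded below.\<close>

lemma cramped_coercive:
  assumes U: "unitary U" and "cramped U"
  shows "\<exists>c \<delta>. cmod c = 1 \<and> \<delta> > 0 \<and> (\<forall>x. \<delta> * (norm x)\<^sup>2 \<le> rinner x (rotated_real_part c U x))"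
proof -
  obtain \<theta>\<^sub>0 where spec: "spectrum U \<subseteq> {cis \<theta> |\<theta>. \<theta>\<^sub>0 < \<theta> \<and> \<theta> < \<theta>\<^sub>0 + pi}"
    using assms(2) by (auto simp: cramped_def)
  \<comment> \<open>Rotates the midpoint of the open semicircle to \<open>1\<close>.\<close>
  define c where "c = cis (- (\<theta>\<^sub>0 + pi / 2))"
  have c: "cmod c = 1" "c * cnj c = 1"
    by (simp_all add: c_def cis_cnj cis_mult)
  note lin = bounded_linear.linear[OF unitary_bounded_linear[OF U]]
  define V where "V x = c *\<^sub>C U x" for x
  have V_norm: "norm (V x) = norm x" for x
    using U by (simp add: V_def norm_scaleC c unitary_norm)
  have below: "\<exists>k>0. \<forall>x. k * norm x \<le> norm (V x - p *\<^sub>C x)"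
    if "p\<^sup>2 - 2 * of_real l * p + 1 = 0" "l \<le> 0" for p l
  proof -
    have "cnj c * p \<notin> spectrum U"
    proof
      assume "cnj c * p \<in> spectrum U"
      then obtain \<theta> where \<theta>: "cnj c * p = cis \<theta>" "\<theta>\<^sub>0 < \<theta>" "\<theta> < \<theta>\<^sub>0 + pi"
        using spec by blast
      define \<phi> where "\<phi> = \<theta> - (\<theta>\<^sub>0 + pi / 2)"
      have "p = c * (cnj c * p)"
        using c(2) by (simp flip: mult.assoc)
      also have "\<dots> = cis \<phi>"
        unfolding \<theta>(1) by (simp add: c_def \<phi>_def cis_mult algebra_simps)
      finally have p: "p = cis \<phi>" .
      \<comment> \<open>On the unit circle the equation for \<open>p\<close> reads \<open>p + cnj p = 2 l\<close>.\<close>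
      have "p + cnj p = cnj p * (p\<^sup>2 + 1)"
        by (simp add: p cis_cnj power2_eq_square cis_mult algebra_simps)
      also have "p\<^sup>2 + 1 = 2 * of_real l * p"
        using that(1) by (simp add: algebra_simps)
      also have "cnj p * (2 * of_real l * p) = 2 * of_real l"
        by (simp add: p cis_cnj cis_mult mult.left_commute)
      finally have "cos \<phi> = l"
        by (simp add: p complex_eq_iff)
      moreover have "cos \<phi> > 0"
        using \<theta> by (intro cos_gt_zero_pi) (auto simp: \<phi>_def)
      ultimately show False
        using that(2) by simp
    qed
    from bounded_below_outside_spectrum[OF this]
    obtain k where k: "k > 0" "\<And>x. k * norm x \<le> norm (U x - (cnj c * p) *\<^sub>C x)"
      by blast
    have "V x - p *\<^sub>C x = c *\<^sub>C (U x - (cnj c * p) *\<^sub>C x)" for x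
      using c(2) by (simp add: V_def scaleC_diff_right scaleC_scaleC flip: mult.assoc)
    then have "norm (V x - p *\<^sub>C x) = norm (U x - (cnj c * p) *\<^sub>C x)" for x
      by (simp add: norm_scaleC c)
    with k show ?thesis
      by auto
  qed
  have "\<exists>\<delta>>0. \<forall>x. \<delta> * (norm x)\<^sup>2 \<le> rinner x (rotated_real_part c U x)"
  proof (rule symmetric_contraction_coercive)
    show "linear (rotated_real_part c U)"
      using linear_rotated_real_part[OF U] bounded_linear.linear by blast
    show "rinner (rotated_real_part c U x) y = rinner x (rotated_real_part c U y)" for x y
      by (rule rotated_real_part_symmetric[OF U])
    show "norm (rotated_real_part c U x) \<le> norm x" for x
      by (rule norm_rotated_real_part[OF U c(1)])
    fix l :: real
    assume l: "l \<le> 0"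
    define r where "r = csqrt (of_real (l\<^sup>2 - 1))"
    define p q where "p = of_real l + r" and "q = of_real l - r"
    have r2: "r\<^sup>2 = of_real (l\<^sup>2 - 1)"
      unfolding r_def by (rule power2_csqrt)
    have root: "p\<^sup>2 - 2 * of_real l * p + 1 = 0" "q\<^sup>2 - 2 * of_real l * q + 1 = 0"
      and pq: "p * q = 1" "p + q = of_real (2 * l)"
      using r2 by (simp_all add: p_def q_def power2_eq_square algebra_simps)
    obtain j where j: "j > 0" "\<And>x. j * norm x \<le> norm (V x - p *\<^sub>C x)"
      using below[OF root(1) l] by blast
    obtain k where k: "k > 0" "\<And>x. k * norm x \<le> norm (V x - q *\<^sub>C x)"
      using below[OF root(2) l] by blast
    have factor: "V (2 *\<^sub>R (rotated_real_part c U x - l *\<^sub>R x))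
        = V (V x - q *\<^sub>C x) - p *\<^sub>C (V x - q *\<^sub>C x)" for x
    proof -
      have *: "V (a + b) = V a + V b" "V (a - b) = V a - V b" "V (e *\<^sub>C a) = e *\<^sub>C V a" for a b e
        by (simp_all add: V_def linear_add[OF lin] linear_diff[OF lin] unitary_scaleC[OF U]
            scaleC_add_right scaleC_diff_right scaleC_scaleC mult.commute)
      have "V (2 *\<^sub>R (rotated_real_part c U x - l *\<^sub>R x))
          = V (V x + cnj c *\<^sub>C inv U x - of_real (2 * l) *\<^sub>C x)"
        unfolding scaleC_of_real by (simp add: rotated_real_part_def V_def algebra_simps)
      also have "\<dots> = V (V x) + x - (p + q) *\<^sub>C V x"
        unfolding * pq(2)
        by (simp add: V_def scaleC_scaleC unitary_inv_right[OF U] c(2) mult.commute)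
      also have "\<dots> = V (V x - q *\<^sub>C x) - p *\<^sub>C (V x - q *\<^sub>C x)"
        unfolding * by (simp add: scaleC_diff_right scaleC_scaleC scaleC_add_left pq(1))
      finally show ?thesis .
    qed
    have "j * k / 2 * norm x \<le> norm (rotated_real_part c U x - l *\<^sub>R x)" for x
    proof -
      have "j * (k * norm x) \<le> j * norm (V x - q *\<^sub>C x)"
        using j(1) k(2) by simp
      also have "\<dots> \<le> norm (V (2 *\<^sub>R (rotated_real_part c U x - l *\<^sub>R x)))"
        unfolding factor by (rule j(2))
      finally show ?thesis
        by (simp add: V_norm)
    qed
    then show "\<exists>k>0. \<forall>x. k * norm x \<le> norm (rotated_real_part c U x - l *\<^sub>R x)"
      using j(1) k(1) by (intro exI[of _ "j * k / 2"]) auto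
  qed
  with c(1) show ?thesis
    by blast
qed


section \<open>Coercive operators exchanging two subspaces\<close>

text \<open>The operator \<open>Y = 1 - sqrt (1 - B)\<close> solves \<open>Y = (B + Y\<^sup>2) / 2\<close>. The fixed point
  iteration for this equation consists of polynomials in \<open>B\<close>.\<close>

primrec root_iterate :: "('a::real_vector \<Rightarrow> 'a) \<Rightarrow> nat \<Rightarrow> 'a \<Rightarrow> 'a" where
  "root_iterate B 0 = (\<lambda>x. 0)"
| "root_iterate B (Suc n) = (\<lambda>x. (1/2) *\<^sub>R (B x + root_iterate B n (root_iterate B n x)))"

lemma linear_root_iterate: "linear B \<Longrightarrow> linear (root_iterate B n)"
proof (induction n)
  case (Suc n)
  then show ?case
    by (auto simp: linear_iff algebra_simps)
qed (simp add: linear_zero)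

lemma root_iterate_mem:
  assumes "subspace M" "\<And>x. x \<in> M \<Longrightarrow> B x \<in> M" "x \<in> M"
  shows "root_iterate B n x \<in> M"
  using assms(3)
  by (induction n arbitrary: x) (auto intro!: subspace_scale subspace_add subspace_0 assms(1,2))

lemma root_iterate_commute:
  assumes "linear H" "\<And>x. H (B x) = B (H x)"
  shows "H (root_iterate B n x) = root_iterate B n (H x)"
  by (induction n arbitrary: x)
    (simp_all add: linear_0[OF assms(1)] linear_scale[OF assms(1)] linear_add[OF assms(1)] assms(2))

text \<open>The norms are dominated by the scalar iteration \<open>t \<mapsto> (b + t\<^sup>2) / 2\<close>, which started at \<open>0\<close>
  does not pass a \<open>q\<close> with \<open>(b + q\<^sup>2) / 2 \<le> q\<close>.\<close>

lemma norm_root_iterate: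
  fixes B :: "'a::real_normed_vector \<Rightarrow> 'a"
  assumes "\<And>x. norm (B x) \<le> b * norm x" "0 \<le> q" "b + q\<^sup>2 \<le> 2 * q"
  shows "norm (root_iterate B n x) \<le> q * norm x"
proof (induction n arbitrary: x)
  case (Suc n)
  let ?Y = "root_iterate B n"
  have "norm (B x + ?Y (?Y x)) \<le> b * norm x + q * (q * norm x)"
    by (intro norm_triangle_le add_mono assms(1) order_trans[OF Suc.IH[of "?Y x"]]
        mult_left_mono Suc.IH assms(2))
  also have "\<dots> = (b + q\<^sup>2) * norm x"
    by (simp add: algebra_simps power2_eq_square)
  also have "\<dots> \<le> 2 * q * norm x"
    by (intro mult_right_mono assms(3)) simp
  finally show ?case
    by simp
qed (simp add: assms(2))

text \<open>With \<open>B = 1 - H\<^sup>2\<close>, the operator \<open>E = 1 - H\<close> is a fixed point of the iteration, and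
  \<open>E - Y\<^sub>n\<^sub>+\<^sub>1 = (E - Y\<^sub>n) (E + Y\<^sub>n) / 2\<close>. Since \<open>\<parallel>E\<parallel> \<le> 1\<close> and \<open>\<parallel>Y\<^sub>n\<parallel> \<le> q < 1\<close>, the error is
  contracted by \<open>(1 + q) / 2\<close>. Norm bounds thus suffice for the convergence to \<open>E\<close>, without an order
  on operators.\<close>

lemma square_invariant_imp_invariant:
  fixes H :: "'a::real_normed_vector \<Rightarrow> 'a"
  assumes lin: "linear H"
    and E_norm: "\<And>x. norm (x - H x) \<le> norm x"
    and B_norm: "\<And>x. norm (x - H (H x)) \<le> b * norm x" and b: "0 \<le> b" "b < 1"
    and M: "closed M" "subspace M" and inv: "\<And>x. x \<in> M \<Longrightarrow> H (H x) \<in> M"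
    and x: "x \<in> M"
  shows "H x \<in> M"
proof -
  define E B Y where "E x = x - H x" and "B x = x - H (H x)" and "Y = root_iterate B" for x
  \<comment> \<open>The smaller root of \<open>b + q\<^sup>2 = 2 q\<close>.\<close>
  define q where "q = 1 - sqrt (1 - b)"
  have q: "0 \<le> q" "q < 1" "b + q\<^sup>2 \<le> 2 * q"
    using b by (auto simp: q_def power2_eq_square algebra_simps)
  have linE: "linear E" and linB: "linear B"
    using lin by (auto simp: linear_iff E_def B_def algebra_simps)
  have linY: "linear (Y n)" for n
    unfolding Y_def by (rule linear_root_iterate[OF linB])
  have comm: "E (Y n z) = Y n (E z)" for n z
    unfolding Y_def
    by (rule root_iterate_commute[OF linE]) (simp add: E_def B_def linear_diff[OF lin])
  have Y_norm: "norm (Y n z) \<le> q * norm z" for n z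
    unfolding Y_def
    by (rule norm_root_iterate[where b = b]) (use B_norm q in \<open>auto simp: B_def\<close>)
  have err: "norm (E z - Y n z) \<le> ((1 + q) / 2) ^ n * norm z" for n z
  proof (induction n arbitrary: z)
    case 0
    then show ?case
      using E_norm by (simp add: Y_def E_def)
  next
    case (Suc n)
    define w where "w = E z + Y n z"
    have B: "B z = 2 *\<^sub>R E z - E (E z)"
      by (simp add: B_def E_def linear_diff[OF lin] algebra_simps scaleR_2)
    have "E z - Y (Suc n) z = (1/2) *\<^sub>R (2 *\<^sub>R E z - B z - Y n (Y n z))"
      by (simp add: Y_def algebra_simps)
    also have "2 *\<^sub>R E z - B z - Y n (Y n z) = E w - Y n w"
      by (simp add: B w_def linear_add[OF linE] linear_add[OF linY] comm)
    finally have "norm (E z - Y (Suc n) z) = norm (E w - Y n w) / 2"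
      by simp
    also have "\<dots> \<le> ((1 + q) / 2) ^ n * norm w / 2"
      using Suc.IH by simp
    also have "norm w \<le> (1 + q) * norm z"
      unfolding w_def using norm_triangle_ineq[of "E z" "Y n z"] Y_norm[of n z] E_norm[of z]
      by (simp add: E_def algebra_simps)
    finally show ?case
      using q by (simp add: mult_left_mono mult_ac)
  qed
  have "(\<lambda>n. E x - Y n x) \<longlonglongrightarrow> 0"
  proof (rule Lim_null_comparison)
    show "(\<lambda>n. ((1 + q) / 2) ^ n * norm x) \<longlonglongrightarrow> 0"
      using q by (intro tendsto_mult_left_zero LIMSEQ_power_zero) auto
  qed (use err in simp)
  then have "(\<lambda>n. E x - (E x - Y n x)) \<longlonglongrightarrow> E x - 0"
    by (intro tendsto_intros)
  then have "(\<lambda>n. Y n x) \<longlonglongrightarrow> E x"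
    by simp
  moreover have "B z \<in> M" if "z \<in> M" for z
    using that M(2) inv by (auto simp: B_def intro: subspace_diff)
  then have "Y n x \<in> M" for n
    unfolding Y_def by (intro root_iterate_mem M(2) x)
  ultimately have "E x \<in> M"
    using closed_sequentially[OF M(1), of "\<lambda>n. Y n x" "E x"] by simp
  then have "x - E x \<in> M"
    by (intro subspace_diff M(2) x)
  then show ?thesis
    by (simp add: E_def)
qed

text \<open>The factor \<open>\<delta>\<close> in \<open>K = \<delta> H\<close> makes \<open>1 - K\<close> a strict contraction:
  \<open>\<parallel>z - K z\<parallel>\<^sup>2 = \<parallel>z\<parallel>\<^sup>2 - 2 \<delta> \<langle>z, H z\<rangle> + \<delta>\<^sup>2 \<parallel>H z\<parallel>\<^sup>2 \<le> (1 - \<delta>\<^sup>2) \<parallel>z\<parallel>\<^sup>2\<close>. Likewise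
  \<open>1 - K\<^sup>2\<close> is a strict contraction because \<open>\<parallel>H z\<parallel> \<ge> \<delta> \<parallel>z\<parallel>\<close>. So \<open>K\<close> preserves \<open>N\<close>, and the
  Neumann series of \<open>K\<close> brings \<open>K x \<in> N\<close> back to \<open>x\<close>.\<close>

lemma coercive_exchange_subset:
  fixes H :: "'a::complex_inner \<Rightarrow> 'a"
  assumes lin: "linear H" and sym: "\<And>x y. rinner (H x) y = rinner x (H y)"
    and contr: "\<And>x. norm (H x) \<le> norm x"
    and coer: "\<And>x. \<delta> * (norm x)\<^sup>2 \<le> rinner x (H x)" and \<delta>: "0 < \<delta>" "\<delta> \<le> 1"
    and M: "subspace M" and N: "closed N" "subspace N"
    and MN: "\<And>x. x \<in> M \<Longrightarrow> H x \<in> N" and NM: "\<And>x. x \<in> N \<Longrightarrow> H x \<in> M"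
  shows "M \<subseteq> N"
proof
  fix x
  assume x: "x \<in> M"
  define K where "K x = \<delta> *\<^sub>R H x" for x
  have linK: "linear K"
    using lin by (auto simp: linear_iff K_def algebra_simps)
  have H_ge: "\<delta> * norm z \<le> norm (H z)" for z
  proof (cases "z = 0")
    case False
    have "norm z * (\<delta> * norm z) \<le> norm z * norm (H z)"
      using coer[of z] abs_rinner_le[of z "H z"] by (simp add: power2_eq_square algebra_simps)
    with False show ?thesis
      by simp
  qed simp
  have E_norm: "norm (z - K z) \<le> sqrt (1 - \<delta>\<^sup>2) * norm z" for z
  proof -
    have "(norm (z - K z))\<^sup>2 = (norm z)\<^sup>2 - 2 * \<delta> * rinner z (H z) + \<delta>\<^sup>2 * (norm (H z))\<^sup>2"
      by (simp add: norm_diff_squared K_def rinner.scaleR_right power_mult_distrib)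
    also have "\<dots> \<le> (norm z)\<^sup>2 - 2 * \<delta> * (\<delta> * (norm z)\<^sup>2) + \<delta>\<^sup>2 * (norm z)\<^sup>2"
      using coer[of z] contr[of z] \<delta> 
      by (intro add_mono diff_mono mult_left_mono power_mono) auto
    also have "\<dots> = (sqrt (1 - \<delta>\<^sup>2) * norm z)\<^sup>2"
      using \<delta> by (simp add: power_mult_distrib power_le_one)
        (simp add: algebra_simps power2_eq_square)
    finally show ?thesis
      by (rule power2_le_imp_le) (use \<delta> in \<open>simp add: power_le_one\<close>)
  qed
  have B_norm: "norm (z - K (K z)) \<le> sqrt (1 - \<delta>^4) * norm z" for z
  proof -
    have "(norm (z - K (K z)))\<^sup>2
        = (norm z)\<^sup>2 - 2 * \<delta>\<^sup>2 * (norm (H z))\<^sup>2 + \<delta>^4 * (norm (H (H z)))\<^sup>2"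
    proof -
      have "K (K z) = \<delta>\<^sup>2 *\<^sub>R H (H z)"
        by (simp add: K_def linear_scale[OF lin] power2_eq_square)
      moreover have "rinner z (H (H z)) = (norm (H z))\<^sup>2"
        by (simp add: rinner_self flip: sym)
      ultimately show ?thesis
        by (simp add: norm_diff_squared rinner.scaleR_right power_mult_distrib)
    qed
    also have "\<dots> \<le> (norm z)\<^sup>2 - 2 * \<delta>\<^sup>2 * (\<delta> * norm z)\<^sup>2 + \<delta>^4 * (norm z)\<^sup>2"
      using H_ge[of z] order_trans[OF contr[of "H z"] contr[of z]] \<delta>
      by (intro add_mono diff_mono mult_left_mono power_mono) auto
    also have "\<dots> = (sqrt (1 - \<delta>^4) * norm z)\<^sup>2"
      using \<delta> by (simp add: power_mult_distrib power_le_one)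
        (simp add: algebra_simps power2_eq_square power4_eq_xxxx)
    finally show ?thesis
      by (rule power2_le_imp_le) (use \<delta> in \<open>simp add: power_le_one\<close>)
  qed
  have K_mem: "K z \<in> N" if "z \<in> N" for z
  proof (rule square_invariant_imp_invariant[OF linK _ B_norm _ _ N _ that])
    show "norm (y - K y) \<le> norm y" for y
      using E_norm[of y] mult_right_mono[of "sqrt (1 - \<delta>\<^sup>2)" 1 "norm y"] by simp
    show "K (K y) \<in> N" if "y \<in> N" for y
      using that N(2) by (simp add: K_def linear_scale[OF lin] subspace_scale MN NM)
  qed (use \<delta> in \<open>auto simp: power_le_one\<close>)
  define E where "E z = z - K z" for z
  have linE: "linear E"
    using linK by (auto simp: linear_iff E_def algebra_simps)
  have E_pow_norm: "norm ((E ^^ n) x) \<le> sqrt (1 - \<delta>\<^sup>2) ^ n * norm x" for n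
  proof (induction n)
    case (Suc n)
    have "norm ((E ^^ Suc n) x) \<le> sqrt (1 - \<delta>\<^sup>2) * norm ((E ^^ n) x)"
      using E_norm by (simp add: E_def)
    also have "\<dots> \<le> sqrt (1 - \<delta>\<^sup>2) * (sqrt (1 - \<delta>\<^sup>2) ^ n * norm x)"
      using Suc.IH \<delta> by (intro mult_left_mono) (auto simp: power_le_one)
    finally show ?case
      by simp
  qed simp
  \<comment> \<open>Partial sums of the Neumann series of \<open>K\<close>, applied to \<open>K x\<close>, which lies in \<open>N\<close>.\<close>
  have partial_sum: "x - (E ^^ n) x \<in> N" for n
  proof (induction n)
    case 0
    then show ?case
      using N(2) by (simp add: subspace_0)
  next
    case (Suc n)
    have "x - (E ^^ Suc n) x = E (x - (E ^^ n) x) + K x"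
      by (simp add: linear_diff[OF linE]) (simp add: E_def)
    moreover have "E (x - (E ^^ n) x) \<in> N"
      unfolding E_def[of "x - (E ^^ n) x"] by (intro subspace_diff N(2) Suc.IH K_mem)
    moreover have "K x \<in> N"
      using x MN N(2) by (simp add: K_def subspace_scale)
    ultimately show ?case
      using N(2) by (simp add: subspace_add)
  qed
  have "(\<lambda>n. (E ^^ n) x) \<longlonglongrightarrow> 0"
  proof (rule Lim_null_comparison)
    show "(\<lambda>n. sqrt (1 - \<delta>\<^sup>2) ^ n * norm x) \<longlonglongrightarrow> 0"
      using \<delta> by (intro tendsto_mult_left_zero LIMSEQ_power_zero) (auto simp: power_le_one)
  qed (use E_pow_norm in simp)
  then have "(\<lambda>n. x - (E ^^ n) x) \<longlonglongrightarrow> x - 0"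
    by (intro tendsto_intros)
  then show "x \<in> N"
    using closed_sequentially[OF N(1), of "\<lambda>n. x - (E ^^ n) x" x] partial_sum by simp
qed

text \<open>The inverse of \<open>U\<close> exchanges \<open>M\<close> and \<open>N\<close> as well, hence so does the coercive operator
  \<open>rotated_real_part c U\<close>, in the sense of mapping each into the other.\<close>

theorem cramped_unitary_exchange:
  assumes U: "unitary U" and cr: "cramped U"
    and M: "closed M" "complex_subspace M" and N: "closed N" "complex_subspace N"
    and UM: "U ` M = N" and UN: "U ` N = M"
  shows "M = N"
proof -
  obtain c \<delta> where c: "cmod c = 1" and \<delta>: "\<delta> > 0"
    and coer: "\<And>x. \<delta> * (norm x)\<^sup>2 \<le> rinner x (rotated_real_part c U x)"
    using cramped_coercive[OF U cr] by blast
  \<comment> \<open>A coercivity constant that is also at most \<open>1\<close>.\<close>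
  have coer': "min \<delta> 1 * (norm x)\<^sup>2 \<le> rinner x (rotated_real_part c U x)" for x
    using coer[of x] mult_right_mono[of "min \<delta> 1" \<delta> "(norm x)\<^sup>2"] by simp
  have lin: "linear (rotated_real_part c U)"
    using linear_rotated_real_part[OF U] bounded_linear.linear by blast
  have maps: "rotated_real_part c U x \<in> Q"
    if "x \<in> P" "U ` P = Q" "U ` Q = P" "complex_subspace Q" for x P Q
  proof -
    have "inv U x \<in> Q"
      using that(1) unfolding that(3)[symmetric] by (auto simp: unitary_inv_left[OF U])
    moreover have "U x \<in> Q"
      using that by blast
    ultimately show ?thesis
      using that(4)
      by (simp add: rotated_real_part_def complex_subspace_def subspace_add subspace_scale)
  qed
  note sub = coercive_exchange_subset[OF lin rotated_real_part_symmetric[OF U]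
      norm_rotated_real_part[OF U c] coer']
  show ?thesis
    using sub[of M N] sub[of N M] \<delta> M N maps[OF _ UM UN N(2)] maps[OF _ UN UM M(2)]
    by (auto simp: complex_subspace_def)
qed

section \<open>Graphs of operators in the product space\<close>

instantiation prod :: (complex_inner, complex_inner) complex_inner
begin

definition scaleC_prod :: "complex \<Rightarrow> 'a \<times> 'b \<Rightarrow> 'a \<times> 'b"
  where "scaleC_prod c p = (c *\<^sub>C fst p, c *\<^sub>C snd p)"

definition cinner_prod :: "'a \<times> 'b \<Rightarrow> 'a \<times> 'b \<Rightarrow> complex"
  where "cinner_prod p q = cinner (fst p) (fst q) + cinner (snd p) (snd q)"

instance
proof
  fix p q r :: "'a \<times> 'b" and c :: complex
  show "cinner p q = cnj (cinner q p)"
    using cinner_commute[of "fst p" "fst q"] cinner_commute[of "snd p" "snd q"]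
    by (simp add: cinner_prod_def)
  show "norm p = sqrt (Re (cinner p p))"
    by (simp add: cinner_prod_def norm_prod_def flip: rinner_def rinner_self)
qed (auto simp: scaleC_prod_def cinner_prod_def scaleC_of_real scaleC_add_left scaleC_add_right
    scaleC_scaleC cinner_add_right cinner_scaleC_right prod_eq_iff algebra_simps)

end

instance prod :: (chilbert_space, chilbert_space) chilbert_space ..

lemma bounded_clinear_map_prod:
  assumes "bounded_clinear A" "bounded_clinear B"
  shows "bounded_clinear (map_prod A B)"
proof -
  have "bounded_linear (\<lambda>p. (A (fst p), B (snd p)))"
    using assms by (auto simp: bounded_clinear_def intro!: bounded_linear_Pair
        bounded_linear_compose[OF _ bounded_linear_fst] bounded_linear_compose[OF _ bounded_linear_snd])
  then show ?thesis
    using assms by (simp add: bounded_clinear_def map_prod_def scaleC_prod_def case_prod_unfold)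
qed

lemma unitary_map_prod: "unitary U \<Longrightarrow> unitary V \<Longrightarrow> unitary (map_prod U V)"
  by (simp add: unitary_def bounded_clinear_map_prod cinner_prod_def map_prod_surj)

lemma cramped_map_prod_self:
  assumes "cramped U"
  shows "cramped (map_prod U U)"
proof -
  have "spectrum (map_prod U U) \<subseteq> spectrum U"
  proof
    fix \<mu>
    assume "\<mu> \<in> spectrum (map_prod U U)"
    moreover have "\<mu> \<notin> spectrum (map_prod U U)" if \<mu>: "\<mu> \<notin> spectrum U"
    proof -
      obtain R where "bounded_clinear R" "\<And>x. R (U x - \<mu> *\<^sub>C x) = x" "\<And>x. U (R x) - \<mu> *\<^sub>C R x = x"
        using \<mu> by (auto simp: spectrum_def)
      then show ?thesis
        unfolding spectrum_def
        by (auto simp: scaleC_prod_def intro!: exI[of _ "map_prod R R"] bounded_clinear_map_prod)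
    qed
    ultimately show "\<mu> \<in> spectrum U"
      by blast
  qed
  with assms show ?thesis
    unfolding cramped_def by (meson subset_trans)
qed

lemma orthocomplement_unitary_image:
  assumes "unitary W"
  shows "W ` orthocomplement S = orthocomplement (W ` S)"
proof
  show "W ` orthocomplement S \<subseteq> orthocomplement (W ` S)"
    using assms by (auto simp: orthocomplement_def unitary_def)
  show "orthocomplement (W ` S) \<subseteq> W ` orthocomplement S"
  proof
    fix x
    assume "x \<in> orthocomplement (W ` S)"
    then have "inv W x \<in> orthocomplement S"
      by (simp add: orthocomplement_def unitary_adjoint[OF assms])
    then show "x \<in> W ` orthocomplement S"
      using unitary_inv_right[OF assms] by (metis imageI)
  qed
qed

text \<open>This turn converts the defining relation \<open>\<langle>y, T x\<rangle> = \<langle>w, x\<rangle>\<close> of the adjoint into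
  orthogonality of \<open>(y, w)\<close> to \<open>(T x, - x)\<close>. Being unitary, it commutes with forming orthogonal
  complements.\<close>

definition quarter_turn :: "'a::complex_inner \<times> 'a \<Rightarrow> 'a \<times> 'a"
  where "quarter_turn p = (snd p, - fst p)"

lemma unitary_quarter_turn: "unitary (quarter_turn :: 'a::complex_inner \<times> 'a \<Rightarrow> _)"
proof -
  have "bounded_linear (\<lambda>p :: 'a \<times> 'a. (snd p, - fst p))"
    by (intro bounded_linear_Pair bounded_linear_minus bounded_linear_fst bounded_linear_snd)
  then have "bounded_clinear (quarter_turn :: 'a \<times> 'a \<Rightarrow> _)"
    by (simp add: bounded_clinear_def quarter_turn_def[abs_def] scaleC_prod_def scaleC_minus_right)
  moreover have "p = quarter_turn (- snd p, fst p)" for p :: "'a \<times> 'a"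
    by (simp add: quarter_turn_def)
  moreover have "cinner (quarter_turn p) (quarter_turn q) = cinner p q" for p q :: "'a \<times> 'a"
  proof -
    have "cinner (- x) (- y) = cinner x y" for x y :: 'a
      using cinner_scaleC_left[of "-1" x "- y"] scaleC_of_real[of "-1" x]
      by (simp add: cinner_minus_right)
    then show ?thesis
      by (simp add: quarter_turn_def cinner_prod_def)
  qed
  ultimately show ?thesis
    unfolding unitary_def surj_def by blast
qed

lemma quarter_turn_twice: "quarter_turn (quarter_turn p) = - p"
  by (simp add: quarter_turn_def prod_eq_iff)

lemma complex_subspace_graph:
  assumes "linear_operator T"
  shows "complex_subspace (Map.graph T)"
proof -
  have scale: "c *\<^sub>C p \<in> Map.graph T" if "p \<in> Map.graph T" for c p
    using that assms by (auto simp: linear_operator_def Map.graph_def scaleC_prod_def)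
  moreover have "r *\<^sub>R p \<in> Map.graph T" if "p \<in> Map.graph T" for r p
    using scale[OF that, of "complex_of_real r"] by (simp add: scaleC_of_real)
  moreover have "0 \<in> Map.graph T"
    using assms by (simp add: linear_operator_def Map.graph_def zero_prod_def)
  moreover have "p + q \<in> Map.graph T" if "p \<in> Map.graph T" "q \<in> Map.graph T" for p q
    using that assms by (auto simp: linear_operator_def Map.graph_def)
  ultimately show ?thesis
    by (simp add: complex_subspace_def subspace_def)
qed

lemma orthogonal_to_dense_eq_0:
  assumes "closure D = UNIV" and "\<And>x. x \<in> D \<Longrightarrow> rinner z x = 0"
  shows "z = 0"
proof -
  have "closed {x. rinner z x = 0}"
    by (intro closed_Collect_eq continuous_intros rinner.continuous_on)
  then have "closure D \<subseteq> {x. rinner z x = 0}"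
    using assms(2) by (intro closure_minimal) auto
  then have "rinner z z = 0"
    using assms(1) by auto
  then show ?thesis
    by (simp add: rinner_self)
qed

lemma adjoint_operator_eq_Some_iff:
  assumes "densely_defined T"
  shows "adjoint_operator T y = Some w \<longleftrightarrow> (\<forall>x\<in>dom T. cinner y (the (T x)) = cinner w x)"
proof -
  have uniq: "w = w'" if "\<forall>x\<in>dom T. cinner y (the (T x)) = cinner w x"
    "\<forall>x\<in>dom T. cinner y (the (T x)) = cinner w' x" for w w'
  proof -
    have "rinner (w - w') x = 0" if "x \<in> dom T" for x
      using that \<open>\<forall>x\<in>dom T. _ = cinner w x\<close> \<open>\<forall>x\<in>dom T. _ = cinner w' x\<close>
      unfolding rinner.diff_left by (simp add: rinner_def)
    then have "w - w' = 0"
      using assms unfolding densely_defined_def by (intro orthogonal_to_dense_eq_0[of "dom T"])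
    then show ?thesis
      by simp
  qed
  have "(THE z. \<forall>x\<in>dom T. cinner y (the (T x)) = cinner z x) = w"
    if "\<forall>x\<in>dom T. cinner y (the (T x)) = cinner w x" for w
    using that uniq by (intro the_equality) blast+
  then show ?thesis
    unfolding adjoint_operator_def by (smt (verit) option.inject option.distinct(1))
qed

lemma graph_adjoint_operator:
  assumes "densely_defined T"
  shows "Map.graph (adjoint_operator T) = orthocomplement (quarter_turn ` Map.graph T)"
proof -
  have "(y, w) \<in> Map.graph (adjoint_operator T)
      \<longleftrightarrow> (y, w) \<in> orthocomplement (quarter_turn ` Map.graph T)" for y w
    by (simp add: graph_eq_to_snd_dom[of T] orthocomplement_def quarter_turn_def cinner_prod_def
        cinner_minus_right Map.graph_def adjoint_operator_eq_Some_iff[OF assms])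
      (auto simp: dom_def)
  then show ?thesis
    by auto
qed

section \<open>Self-adjointness\<close>

theorem theorem3p3:
  fixes U :: "'a::chilbert_space \<Rightarrow> 'a"
    and T :: "'a \<rightharpoonup> 'a"
  assumes "separable_space (euclidean :: 'a topology)"
    and "unitary U"
    and "cramped U"
    and "linear_operator T"
    and "densely_defined T"
    and "closed_operator T"
    and "everywhere U \<circ>\<^sub>m T = adjoint_operator T \<circ>\<^sub>m everywhere U"
  shows "self_adjoint T"
proof -
  define W where "W = map_prod U U"
  define G where "G = Map.graph T"
  define G' where "G' = Map.graph (adjoint_operator T)"
  have W: "unitary W" "cramped W"
    unfolding W_def by (rule unitary_map_prod cramped_map_prod_self assms)+
  have G: "closed G" "complex_subspace G"
    using assms(4,6) by (simp_all add: G_def complex_subspace_graph closed_operator_def)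
  have G'_eq: "G' = orthocomplement (quarter_turn ` G)"
    unfolding G'_def G_def by (rule graph_adjoint_operator[OF assms(5)])
  have eq: "map_option U (T x) = adjoint_operator T (U x)" for x
    using fun_cong[OF assms(7), of x]
    by (simp add: everywhere_def map_comp_def split: option.splits)
  have WG: "W ` G = G'"
  proof
    show "W ` G \<subseteq> G'"
    proof
      fix p
      assume "p \<in> W ` G"
      then obtain x u where "T x = Some u" "p = (U x, U u)"
        by (auto simp: W_def G_def Map.graph_def)
      then show "p \<in> G'"
        using eq[of x] by (simp add: G'_def Map.graph_def)
    qed
    show "G' \<subseteq> W ` G"
    proof
      fix p
      assume "p \<in> G'"
      then obtain y w where p: "p = (y, w)" "adjoint_operator T y = Some w"
        by (auto simp: G'_def Map.graph_def)
      then obtain u where "T (inv U y) = Some u" "U u = w"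
        using eq[of "inv U y"] by (auto simp: unitary_inv_right[OF assms(2)])
      then have "(inv U y, u) \<in> G" "p = W (inv U y, u)"
        by (simp_all add: p W_def G_def Map.graph_def unitary_inv_right[OF assms(2)])
      then show "p \<in> W ` G"
        by blast
    qed
  qed
  have commute: "W (quarter_turn p) = quarter_turn (W p)" for p
    using linear_neg[OF bounded_linear.linear[OF unitary_bounded_linear[OF assms(2)]]]
    by (simp add: W_def quarter_turn_def map_prod_def case_prod_unfold)
  \<comment> \<open>Two quarter turns amount to the sign change, which preserves the subspace \<open>G\<close>.\<close>
  have neg: "quarter_turn ` quarter_turn ` G = G"
  proof -
    have "- p \<in> G" if "p \<in> G" for p
      using that G(2) by (simp add: complex_subspace_def subspace_neg)
    then show ?thesis
      by (force simp: image_image quarter_turn_twice)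
  qed
  have "W ` G' = orthocomplement (quarter_turn ` W ` G)"
    unfolding G'_eq orthocomplement_unitary_image[OF W(1)] by (simp add: image_image commute)
  also have "\<dots> = orthocomplement (quarter_turn ` orthocomplement (quarter_turn ` G))"
    by (simp only: WG G'_eq)
  also have "\<dots> = orthocomplement (orthocomplement G)"
    by (simp only: orthocomplement_unitary_image[OF unitary_quarter_turn] neg)
  also have "\<dots> = G"
    by (rule double_orthocomplement[OF G])
  finally have WG': "W ` G' = G" .
  have "G = G'"
    by (rule cramped_unitary_exchange[OF W G _ _ WG WG'])
      (simp_all add: G'_eq closed_orthocomplement complex_subspace_orthocomplement)
  then have "T x = Some u \<longleftrightarrow> adjoint_operator T x = Some u" for x u
    by (auto simp: G_def G'_def Map.graph_def)
  then show ?thesis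
    unfolding self_adjoint_def by (intro ext) (metis not_Some_eq)
qed

end
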